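(* Let $t_0>0$, $\tau>0$, $a\in C([0,\infty),\mathbb{R})$, $b,c\in C([0,\infty),[0,\infty))$ with $b\not\equiv 0$ or $c\not\equiv 0$; let $t_0<t_1<t_2<\cdots$ be real numbers with $\lim_{i\to\infty}t_i=\infty$, and let $b_i\in(-\infty,1)$ for $i=1,2,\dots$. Put $l=\min\{\tau,1\}$. If at least one of the following two conditions holds: $$\limsup_{t\to\infty}\int_{t-l}^{t}\Big(\prod_{s-\tau<t_j\le s}(1-b_j)\Big)b(s)\exp\Big(\int_{s-\tau}^{s}a(u)\,du\Big)ds>1,$$ $$\limsup_{n\to\infty,\ n\in\mathbb{N}}\int_{n+1-l}^{n+1}\Big(\prod_{n-1<t_j\le s}(1-b_j)\Big)c(s)\exp\Big(\int_{n-1}^{s}a(u)\,du\Big)ds>1,$$ then every solution of the impulsive equation $$x'(t)+a(t)x(t)+b(t)x(t-\tau)+c(t)x([t-1])=0,\ t\ne t_i,\ t\ge t_0;\qquad \Delta x(t_i)=b_ix(t_i),\ i=1,2,\dots$$ is oscillatory.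
   Context: $[\cdot]$ is the greatest integer function. $\Delta x(t_i)=x(t_i^+)-x(t_i^-)$, where $x(t_i^\pm)$ are the one-sided limits. An empty product equals $1$. A solution of the impulsive equation is a function $x:\{-1\}\cup[-\tau,\infty)\to\mathbb{R}$ such that: - $x$ is continuous on $[-\tau,\infty)$ except possibly at the points $t_i$, $i\ge1$; - $x$ is right continuous and has a left-hand limit at each $t_i$; - for every $t\ge t_0$ that is neither one of the $t_i$ ($i\ge 1$) nor an integer, $x$ is differentiable at $t$ (from the right if $t=t_0$) and satisfies the differential equation. At the points $t_i$ and the integers $t\ge t_0$, one-sided derivatives exist (the left derivative at $t_i$ being computed with the value $x(t_i^-)$); - $\Delta x(t_i)=b_ix(t_i)$ for all $i\ge1$. Since $x$ is right continuous, this means $x(t_i^-)=(1-b_i)x(t_i)$. A function is oscillatory if it is neither eventually positive (positive for all sufficiently large $t$) nor eventually negative (negative for all sufficiently large $t$). *)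

theory Defs
  imports "HOL-Analysis.Analysis"
begin

text \<open>
  A solution is modelled as a total function \<open>x :: real \<Rightarrow> real\<close> of which only the values on
  \<open>{-1} \<union> {-\<tau>..}\<close> are constrained. The sequence \<open>T\<close> collects the initial time \<open>T 0\<close> and the
  impulse times \<open>T 1 < T 2 < \<dots>\<close>; index \<open>0\<close> is not an impulse, so \<open>\<beta> 0\<close> plays no role.
\<close>

definition jump :: "(real \<Rightarrow> real) \<Rightarrow> real \<Rightarrow> real" where
  "jump x t = Lim (at_right t) x - Lim (at_left t) x"

definition impulse_times :: "(nat \<Rightarrow> real) \<Rightarrow> real set" where
  "impulse_times T = T ` {1..}"

text \<open>
  At \<open>t = T 0\<close> the filter \<open>at t within {T 0..}\<close> gives the right derivative; for \<open>t > T 0\<close> it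
  coincides with \<open>at t\<close>. The left derivative is computed with the left limit \<open>x(t-)\<close> in place
  of \<open>x t\<close>, whence the function update; it is not required at the initial time, to the left of
  which \<open>x\<close> is only a continuous initial function.
\<close>

definition impulsive_solution ::
  "real \<Rightarrow> (real \<Rightarrow> real) \<Rightarrow> (real \<Rightarrow> real) \<Rightarrow> (real \<Rightarrow> real) \<Rightarrow>
   (nat \<Rightarrow> real) \<Rightarrow> (nat \<Rightarrow> real) \<Rightarrow> (real \<Rightarrow> real) \<Rightarrow> bool" where
  "impulsive_solution \<tau> a b c T \<beta> x \<longleftrightarrow>
     (\<forall>t\<ge>-\<tau>. t \<notin> impulse_times T \<longrightarrow> continuous (at t within {-\<tau>..}) x) \<and>
     (\<forall>i\<ge>1. continuous (at_right (T i)) x \<and> (\<exists>L. (x \<longlongrightarrow> L) (at_left (T i)))) \<and>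
     (\<forall>t\<ge>T 0. t \<notin> impulse_times T \<and> t \<notin> \<int> \<longrightarrow>
        (\<exists>D. (x has_real_derivative D) (at t within {T 0..}) \<and>
             D + a t * x t + b t * x (t - \<tau>) + c t * x (of_int \<lfloor>t - 1\<rfloor>) = 0)) \<and>
     (\<forall>t\<ge>T 0. t \<in> impulse_times T \<or> t \<in> \<int> \<longrightarrow>
        (\<exists>D. (x has_real_derivative D) (at_right t)) \<and>
        (t > T 0 \<longrightarrow> (\<exists>D. (x(t := Lim (at_left t) x) has_real_derivative D) (at_left t)))) \<and>
     (\<forall>i\<ge>1. jump x (T i) = \<beta> i * x (T i))"

definition oscillatory :: "(real \<Rightarrow> real) \<Rightarrow> bool" where
  "oscillatory x \<longleftrightarrow>
     \<not> (\<forall>\<^sub>F t in at_top. x t > 0) \<and> \<not> (\<forall>\<^sub>F t in at_top. x t < 0)"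

text \<open>The product of \<open>1 - \<beta> j\<close> over the impulse times in the half-open interval \<open>(p, q]\<close>.\<close>

definition impulse_prod :: "(nat \<Rightarrow> real) \<Rightarrow> (nat \<Rightarrow> real) \<Rightarrow> real \<Rightarrow> real \<Rightarrow> real" where
  "impulse_prod T \<beta> p q = (\<Prod>j | 1 \<le> j \<and> p < T j \<and> T j \<le> q. 1 - \<beta> j)"

end

theory Submission imports Defs begin

text \<open>
  Multiplying a solution \<open>x\<close> by the impulse product and by \<open>exp (\<integral> a)\<close> yields a function \<open>y\<close>
  that is continuous across the impulses and satisfies
  \<open>y' = - (positive factor) * (b x(t - \<tau>) + c x([t - 1]))\<close>. If \<open>x\<close> is eventually positive, then
  \<open>y\<close> is eventually positive and nonincreasing. In \<open>y v - y u = \<integral> y'\<close> the delayed values of \<open>y\<close>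
  are then at least \<open>y u\<close>, so that \<open>y v \<le> y u * (1 - I)\<close>, where \<open>I\<close> is one of the two integrals
  of the theorem; this is impossible if \<open>I > 1\<close>. An eventually negative solution is replaced by
  its negative.
\<close>

section \<open>Products over impulse times\<close>

locale impulses =
  fixes T \<beta> :: "nat \<Rightarrow> real"
  assumes strict_mono_T: "strict_mono T"
    and T_at_top: "filterlim T at_top sequentially"
    and \<beta>_less_1: "\<And>i. i \<ge> 1 \<Longrightarrow> \<beta> i < 1"
begin

lemma finite_impulses: "finite {j. 1 \<le> j \<and> p < T j \<and> T j \<le> q}"
proof -
  obtain N where "\<forall>n\<ge>N. T n \<ge> q + 1"
    using T_at_top unfolding filterlim_at_top eventually_sequentially by blast
  then have "{j. 1 \<le> j \<and> p < T j \<and> T j \<le> q} \<subseteq> {..<N}"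
    by (smt (verit) lessThan_iff mem_Collect_eq not_le subsetI)
  then show ?thesis
    using finite_subset by blast
qed

lemma finite_impulse_times_Int: "finite (impulse_times T \<inter> {p<..q})"
proof -
  have "impulse_times T \<inter> {p<..q} = T ` {j. 1 \<le> j \<and> p < T j \<and> T j \<le> q}"
    by (auto simp: impulse_times_def)
  then show ?thesis
    using finite_impulses by simp
qed

lemma impulse_prod_pos: "impulse_prod T \<beta> p q > 0"
  unfolding impulse_prod_def by (rule prod_pos) (use \<beta>_less_1 in auto)

lemma impulse_prod_mult:
  assumes "p \<le> q" "q \<le> r"
  shows "impulse_prod T \<beta> p r = impulse_prod T \<beta> p q * impulse_prod T \<beta> q r"
proof -
  have "{j. 1 \<le> j \<and> p < T j \<and> T j \<le> r} =
      {j. 1 \<le> j \<and> p < T j \<and> T j \<le> q} \<union> {j. 1 \<le> j \<and> q < T j \<and> T j \<le> r}"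
    using assms by auto
  then show ?thesis
    unfolding impulse_prod_def
    by (simp only:) (intro prod.union_disjoint finite_impulses, auto)
qed

lemma impulse_prod_eq_1:
  assumes "impulse_times T \<inter> {p<..q} = {}"
  shows "impulse_prod T \<beta> p q = 1"
proof -
  have "{j. 1 \<le> j \<and> p < T j \<and> T j \<le> q} = {}"
    using assms by (auto simp: impulse_times_def)
  then show ?thesis
    by (simp only: impulse_prod_def prod.empty)
qed

lemma impulse_prod_single:
  assumes "impulse_times T \<inter> {p<..q} = {T i}"
  shows "impulse_prod T \<beta> p q = 1 - \<beta> i"
proof -
  have "T ` {j. 1 \<le> j \<and> p < T j \<and> T j \<le> q} = T ` {i}"
    unfolding image_insert image_empty assms(1)[symmetric] by (auto simp: impulse_times_def)
  then have "{j. 1 \<le> j \<and> p < T j \<and> T j \<le> q} = {i}"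
    by (simp only: inj_image_eq_iff[OF strict_mono_imp_inj_on[OF strict_mono_T]])
  then show ?thesis
    unfolding impulse_prod_def by simp
qed

text \<open>Only finitely many impulse times lie in a bounded window, so those other than
  \<open>t\<close> form a closed set, and some closed ball around \<open>t\<close> misses
  it.\<close>

lemma impulse_times_isolated:
  obtains e where "e > 0" "impulse_times T \<inter> {t - e..t + e} \<subseteq> {t}"
proof -
  have "open (- (impulse_times T \<inter> {t - 1<..t + 1} - {t}))"
    by (intro open_Compl finite_imp_closed finite_Diff finite_impulse_times_Int)
  moreover have "t \<in> - (impulse_times T \<inter> {t - 1<..t + 1} - {t})" by simp
  ultimately obtain d where d: "d > 0" "cball t d \<subseteq> - (impulse_times T \<inter> {t - 1<..t + 1} - {t})"
    unfolding open_contains_cball by blast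
  \<comment> \<open>The cap \<open>1/2\<close> keeps the closed interval inside the window of radius
    1 in which finiteness was used.\<close>
  have "impulse_times T \<inter> {t - min d (1/2)..t + min d (1/2)} \<subseteq> {t}"
  proof
    fix s assume s: "s \<in> impulse_times T \<inter> {t - min d (1/2)..t + min d (1/2)}"
    then have "s \<in> cball t d" by (auto simp: dist_real_def)
    with d(2) s show "s \<in> {t}" by (auto simp: min_def split: if_splits)
  qed
  with d(1) show ?thesis by (intro that[of "min d (1/2)"]) auto
qed

text \<open>The half-open convention already counts an impulse at \<open>t\<close> in the product up
  to \<open>t\<close>. A further factor could only come from a later impulse time, and these keep a
  distance from \<open>t\<close>.\<close>

lemma eventually_impulse_prod_right:
  assumes "p \<le> t"
  shows "\<forall>\<^sub>F s in at_right t. impulse_prod T \<beta> p s = impulse_prod T \<beta> p t"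
proof -
  obtain e where e: "e > 0" "impulse_times T \<inter> {t - e..t + e} \<subseteq> {t}"
    by (rule impulse_times_isolated)
  have "impulse_prod T \<beta> p s = impulse_prod T \<beta> p t" if "t < s" "s < t + e" for s
  proof -
    have "impulse_times T \<inter> {t<..s} = {}"
    proof -
      have "impulse_times T \<inter> {t<..s} \<subseteq> (impulse_times T \<inter> {t - e..t + e}) - {t}"
        using that e(1) by auto
      then show ?thesis using e(2) by blast
    qed
    then show ?thesis
      using impulse_prod_mult[of p t s] impulse_prod_eq_1[of t s] assms that by simp
  qed
  then show ?thesis
    unfolding eventually_at_right_field using e(1) by (intro exI[of _ "t + e"]) auto
qed

text \<open>Just before \<open>t\<close> the product still lacks the factor of a possible impulse at
  \<open>t\<close>. The split isolates that factor, which later cancels the jump of the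
  solution.\<close>

lemma eventually_impulse_prod_left:
  assumes "p < t"
  shows "\<forall>\<^sub>F s in at_left t. impulse_prod T \<beta> p t = impulse_prod T \<beta> p s * impulse_prod T \<beta> s t
    \<and> impulse_times T \<inter> {s<..t} = impulse_times T \<inter> {t}"
proof -
  obtain e where e: "e > 0" "impulse_times T \<inter> {t - e..t + e} \<subseteq> {t}"
    by (rule impulse_times_isolated)
  have "impulse_prod T \<beta> p t = impulse_prod T \<beta> p s * impulse_prod T \<beta> s t
    \<and> impulse_times T \<inter> {s<..t} = impulse_times T \<inter> {t}" if "max p (t - e) < s" "s < t" for s
  proof
    show "impulse_prod T \<beta> p t = impulse_prod T \<beta> p s * impulse_prod T \<beta> s t"
      by (rule impulse_prod_mult) (use that in auto)
    have "impulse_times T \<inter> {s<..t} \<subseteq> impulse_times T \<inter> {t - e..t + e}"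
      using that e(1) by auto
    with e(2) that show "impulse_times T \<inter> {s<..t} = impulse_times T \<inter> {t}" by auto
  qed
  then show ?thesis
    unfolding eventually_at_left_field
    using e(1) assms by (intro exI[of _ "max p (t - e)"]) auto
qed

end

section \<open>The equation and the weighted solution\<close>

text \<open>
  The part of the notion of solution that the argument uses, in a form that is evidently
  invariant under negation of \<open>x\<close>.
\<close>

locale impulsive_equation = impulses +
  fixes \<tau> :: real and a b c x :: "real \<Rightarrow> real"
  assumes T0_pos: "T 0 > 0" and \<tau>_pos: "\<tau> > 0"
    and cont_a: "continuous_on {0..} a"
    and b_nonneg: "\<And>t. t \<ge> 0 \<Longrightarrow> b t \<ge> 0"
    and c_nonneg: "\<And>t. t \<ge> 0 \<Longrightarrow> c t \<ge> 0"
    and x_cont: "\<And>t. t > T 0 \<Longrightarrow> t \<notin> impulse_times T \<Longrightarrow> isCont x t"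
    and x_right: "\<And>i. i \<ge> 1 \<Longrightarrow> (x \<longlongrightarrow> x (T i)) (at_right (T i))"
    and x_left: "\<And>i. i \<ge> 1 \<Longrightarrow> (x \<longlongrightarrow> (1 - \<beta> i) * x (T i)) (at_left (T i))"
    and x_deriv: "\<And>t. t > T 0 \<Longrightarrow> t \<notin> impulse_times T \<Longrightarrow> t \<notin> \<int> \<Longrightarrow>
      (x has_real_derivative - (a t * x t + b t * x (t - \<tau>) + c t * x (of_int \<lfloor>t - 1\<rfloor>))) (at t)"
begin

text \<open>Linearity of the equation and homogeneity of the jump condition reduce eventually
  negative solutions to eventually positive ones.\<close>

lemma uminus: "impulsive_equation T \<beta> \<tau> a b c (\<lambda>t. - x t)"
proof unfold_locales
  fix i :: nat assume i: "i \<ge> 1"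
  show "((\<lambda>t. - x t) \<longlongrightarrow> - x (T i)) (at_right (T i))"
    using x_right[OF i] by (rule tendsto_minus)
  show "((\<lambda>t. - x t) \<longlongrightarrow> (1 - \<beta> i) * - x (T i)) (at_left (T i))"
    using tendsto_minus[OF x_left[OF i]] by simp
next
  fix t assume t: "t > T 0" "t \<notin> impulse_times T"
  show "isCont (\<lambda>t. - x t) t"
    using x_cont[OF t] by simp
  assume "t \<notin> \<int>"
  from DERIV_minus[OF x_deriv[OF t this]]
  show "((\<lambda>t. - x t) has_real_derivative
      - (a t * - x t + b t * - x (t - \<tau>) + c t * - x (of_int \<lfloor>t - 1\<rfloor>))) (at t)"
    by (simp add: algebra_simps)
qed (use T0_pos \<tau>_pos cont_a b_nonneg c_nonneg in auto)

text \<open>The integrating factor of the equation without delayed terms: for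
  \<open>b = c = 0\<close> and \<open>T 0 \<le> p \<le> t\<close>, solutions satisfy
  \<open>x p = weight p t * x t\<close>. With \<open>p\<close> set to the delayed argument it is
  also the kernel in the two integrals of the theorem.\<close>

definition weight :: "real \<Rightarrow> real \<Rightarrow> real" where
  "weight p t = impulse_prod T \<beta> p t * exp (integral {p..t} a)"

lemma weight_pos: "weight p t > 0"
  by (simp add: weight_def impulse_prod_pos)

lemma a_integrable: "0 \<le> p \<Longrightarrow> a integrable_on {p..q}"
  by (rule integrable_continuous_real, rule continuous_on_subset[OF cont_a]) auto

lemma weight_mult:
  assumes "0 \<le> p" "p \<le> q" "q \<le> r"
  shows "weight p r = weight p q * weight q r"
proof -
  have "integral {p..q} a + integral {q..r} a = integral {p..r} a"
    by (rule Henstock_Kurzweil_Integration.integral_combine) (use assms a_integrable in auto)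
  then show ?thesis
    using impulse_prod_mult[OF assms(2,3)] exp_add[of "integral {p..q} a" "integral {q..r} a"]
    by (simp add: weight_def)
qed

lemma exp_integral_deriv:
  assumes "0 \<le> p" "p < t"
  shows "((\<lambda>t. exp (integral {p..t} a)) has_real_derivative a t * exp (integral {p..t} a)) (at t)"
proof -
  \<comment> \<open>The endpoint \<open>t + 1\<close> makes \<open>t\<close> interior, so that the
    derivative within the interval is two-sided.\<close>
  have "((\<lambda>t. integral {p..t} a) has_real_derivative a t) (at t within {p..t + 1})"
    by (rule integral_has_real_derivative)
      (use assms in \<open>auto intro: continuous_on_subset[OF cont_a]\<close>)
  then have "((\<lambda>t. integral {p..t} a) has_real_derivative a t) (at t)"
    using assms by (simp add: at_within_Icc_at)
  from DERIV_fun_exp[OF this] show ?thesis by (simp add: mult.commute)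
qed

text \<open>This is the function \<open>y\<close> of the opening outline, with base point
  \<open>p\<close>.\<close>

definition weighted :: "real \<Rightarrow> real \<Rightarrow> real" where
  "weighted p t = weight p t * x t"

text \<open>At an impulse the left limit of \<open>x\<close> carries an extra factor
  \<open>1 - \<beta> i\<close>, which is exactly the factor that the product does not yet contain to
  the left of \<open>t\<close>.\<close>

lemma weighted_cont:
  assumes "T 0 \<le> p" "p < t"
  shows "isCont (weighted p) t"
proof -
  have "0 \<le> p" using assms T0_pos by simp
  let ?P = "impulse_prod T \<beta> p" and ?E = "\<lambda>t. exp (integral {p..t} a)"
  have E: "(?E \<longlongrightarrow> ?E t) (at t within S)" for S
    using DERIV_isCont[OF exp_integral_deriv[OF \<open>0 \<le> p\<close> assms(2)]]
    by (auto simp: isCont_def intro: tendsto_within_subset)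
  have xr: "(x \<longlongrightarrow> x t) (at_right t)"
    and xl: "((\<lambda>s. ?P s * x s) \<longlongrightarrow> ?P t * x t) (at_left t)"
  proof -
    consider (imp) i where "i \<ge> 1" "t = T i" | (nimp) "t \<notin> impulse_times T"
      by (auto simp: impulse_times_def)
    then have "(x \<longlongrightarrow> x t) (at_right t) \<and> ((\<lambda>s. ?P s * x s) \<longlongrightarrow> ?P t * x t) (at_left t)"
    proof cases
      case imp
      \<comment> \<open>The quotient is the value of the product just before the impulse;
        \<open>\<beta> i < 1\<close> keeps its denominator nonzero.\<close>
      have "((\<lambda>s. ?P t / (1 - \<beta> i) * x s) \<longlongrightarrow> ?P t / (1 - \<beta> i) * ((1 - \<beta> i) * x t)) (at_left t)"
        using x_left[OF imp(1)] imp(2) by (intro tendsto_intros) auto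
      moreover have "\<forall>\<^sub>F s in at_left t. ?P t / (1 - \<beta> i) * x s = ?P s * x s"
        using eventually_impulse_prod_left[OF assms(2)]
      proof eventually_elim
        case (elim s)
        then have "impulse_prod T \<beta> s t = 1 - \<beta> i"
          using imp by (intro impulse_prod_single) (auto simp: impulse_times_def)
        then show ?case using elim \<beta>_less_1[OF imp(1)] by simp
      qed
      ultimately have "((\<lambda>s. ?P s * x s) \<longlongrightarrow> ?P t / (1 - \<beta> i) * ((1 - \<beta> i) * x t)) (at_left t)"
        by (rule Lim_transform_eventually)
      then show ?thesis
        using x_right[OF imp(1)] imp \<beta>_less_1[OF imp(1)] by simp
    next
      case nimp
      have lim: "(x \<longlongrightarrow> x t) (at t within S)" for S
        using x_cont[of t] nimp assms by (auto simp: isCont_def intro: tendsto_within_subset)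
      have "((\<lambda>s. ?P t * x s) \<longlongrightarrow> ?P t * x t) (at_left t)"
        by (intro tendsto_intros lim)
      moreover have "\<forall>\<^sub>F s in at_left t. ?P t * x s = ?P s * x s"
        using eventually_impulse_prod_left[OF assms(2)]
        by eventually_elim (use nimp impulse_prod_eq_1 in auto)
      ultimately have "((\<lambda>s. ?P s * x s) \<longlongrightarrow> ?P t * x t) (at_left t)"
        by (rule Lim_transform_eventually)
      then show ?thesis using lim by blast
    qed
    then show "(x \<longlongrightarrow> x t) (at_right t)"
      and "((\<lambda>s. ?P s * x s) \<longlongrightarrow> ?P t * x t) (at_left t)" by auto
  qed
  have "((\<lambda>s. ?P t * x s) \<longlongrightarrow> ?P t * x t) (at_right t)"
    by (intro tendsto_intros xr)
  moreover have "\<forall>\<^sub>F s in at_right t. ?P t * x s = ?P s * x s"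
    using eventually_impulse_prod_right[OF less_imp_le[OF assms(2)]]
    by eventually_elim simp
  ultimately have "((\<lambda>s. ?P s * x s) \<longlongrightarrow> ?P t * x t) (at_right t)"
    by (rule Lim_transform_eventually)
  with xl have "((\<lambda>s. ?P s * x s) \<longlongrightarrow> ?P t * x t) (at t)"
    by (rule filterlim_split_at)
  then have "((\<lambda>s. ?P s * x s * ?E s) \<longlongrightarrow> ?P t * x t * ?E t) (at t)"
    by (rule tendsto_mult) (rule E)
  then show ?thesis
    by (simp add: isCont_def weighted_def[abs_def] weight_def mult_ac)
qed

text \<open>Minus the derivative of \<open>weighted p\<close> away from impulses and integers; the
  exponential factor has absorbed the term with \<open>a\<close>.\<close>

definition decay :: "real \<Rightarrow> real \<Rightarrow> real" where
  "decay p t = weight p t * (b t * x (t - \<tau>) + c t * x (of_int \<lfloor>t - 1\<rfloor>))"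

text \<open>Near a point that is not an impulse time the product is constant, so only the
  exponential and \<open>x\<close> are differentiated.\<close>

lemma weighted_deriv:
  assumes "T 0 \<le> p" "p < t" "t \<notin> impulse_times T" "t \<notin> \<int>"
  shows "(weighted p has_real_derivative - decay p t) (at t)"
proof -
  have p: "0 \<le> p" "T 0 < t" using assms T0_pos by auto
  let ?P = "impulse_prod T \<beta> p" and ?E = "\<lambda>t. exp (integral {p..t} a)"
  have "\<forall>\<^sub>F s in at_left t. ?P t = ?P s"
    using eventually_impulse_prod_left[OF assms(2)]
    by eventually_elim (use assms(3) impulse_prod_eq_1 in auto)
  moreover have "\<forall>\<^sub>F s in at_right t. ?P t = ?P s"
    using eventually_impulse_prod_right[OF less_imp_le[OF assms(2)]]
    by eventually_elim simp
  ultimately have "\<forall>\<^sub>F s in at t. ?P t = ?P s"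
    by (simp add: eventually_at_split)
  then have ev: "\<forall>\<^sub>F s in nhds t. ?P t * (?E s * x s) = weighted p s"
    by (auto simp: eventually_at_filter weighted_def weight_def elim!: eventually_mono)
  have "((\<lambda>s. ?P t * (?E s * x s)) has_real_derivative - decay p t) (at t)"
    by (rule derivative_eq_intros exp_integral_deriv x_deriv assms p refl)+
      (simp add: decay_def weight_def algebra_simps)
  then show ?thesis
    using DERIV_cong_ev[OF refl ev refl] by simp
qed

section \<open>The integrated equation\<close>

text \<open>\<open>weighted p\<close> is continuous and its derivative is known outside a finite
  set, so the fundamental theorem of calculus yields the integrability of \<open>decay p\<close>
  together with the value.\<close>

lemma decay_has_integral:
  assumes "T 0 \<le> p" "p < u" "u \<le> v"
  shows "((\<lambda>t. - decay p t) has_integral (weighted p v - weighted p u)) {u..v}"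
proof (rule fundamental_theorem_of_calculus_interior_strong)
  let ?S = "impulse_times T \<inter> {u<..v} \<union> {t \<in> \<int>. u \<le> t \<and> t \<le> v}"
  show "finite ?S"
    by (intro finite_UnI finite_impulse_times_Int finite_int_segment)
  show "continuous_on {u..v} (weighted p)"
    using assms by (intro continuous_at_imp_continuous_on ballI weighted_cont) auto
  fix t assume "t \<in> {u<..<v} - ?S"
  then show "(weighted p has_vector_derivative - decay p t) (at t)"
    using weighted_deriv[OF assms(1), of t] assms
    by (auto simp: has_real_derivative_iff_has_vector_derivative)
qed (use assms in auto)

text \<open>The lower bound on \<open>decay p\<close> leaves out \<open>s = v\<close>: in the
  application to \<open>c\<close>, the floor in the delayed argument jumps at the right
  endpoint.\<close>

lemma weighted_le:
  assumes "T 0 \<le> p" "p < u" "u \<le> v"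
    and g: "g integrable_on {u..v}" and le: "\<And>s. u \<le> s \<Longrightarrow> s < v \<Longrightarrow> K * g s \<le> decay p s"
  shows "weighted p v \<le> weighted p u - K * integral {u..v} g"
proof -
  have "((\<lambda>s. - (K * g s)) has_integral - (K * integral {u..v} g)) {u..v}"
    by (intro has_integral_neg has_integral_mult_right integrable_integral g)
  \<comment> \<open>Changing the integrand at the single point \<open>v\<close> makes the comparison
    hold there as an equality and leaves the integral as it is.\<close>
  moreover have "((\<lambda>s. if s = v then - (K * g s) else - decay p s)
      has_integral (weighted p v - weighted p u)) {u..v}"
    by (rule has_integral_spike_finite[OF _ _ decay_has_integral, of "{v}"]) (use assms in auto)
  ultimately have "weighted p v - weighted p u \<le> - (K * integral {u..v} g)"
    using le by (rule_tac has_integral_le) auto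
  then show ?thesis by simp
qed

text \<open>With \<open>K = weighted p u\<close>, an integral above 1 would push
  \<open>weighted p v\<close> below zero.\<close>

lemma integral_le_1:
  assumes "T 0 \<le> p" "p < u" "u \<le> v" "0 < weighted p u" "0 < weighted p v"
    and "\<And>s. u \<le> s \<Longrightarrow> s < v \<Longrightarrow> weighted p u * g s \<le> decay p s"
  shows "integral {u..v} g \<le> 1"
proof (cases "g integrable_on {u..v}")
  case True
  from weighted_le[OF assms(1-3) this assms(6)]
  have "weighted p u * integral {u..v} g < weighted p u * 1" using assms(5) by linarith
  then have "integral {u..v} g < 1" using assms(4) by (simp only: mult_less_cancel_left_pos)
  then show ?thesis by simp
\<comment> \<open>Without integrability \<open>integral\<close> takes its default value 0, so the
  bound still holds.\<close>
qed (simp add: not_integrable_integral)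

text \<open>Trades a delayed value of \<open>x\<close> for a value of \<open>weighted p\<close> at
  the same point, to which monotonicity applies.\<close>

lemma weighted_eq:
  assumes "0 \<le> p" "p \<le> w" "w \<le> s"
  shows "weight p s * x w = weight w s * weighted p w"
  using weight_mult[OF assms] by (simp add: weighted_def)

section \<open>Bounds from an eventually positive solution\<close>

context
  fixes p :: real
  assumes T0_le_p: "T 0 \<le> p" and x_pos: "\<And>t. t \<ge> p \<Longrightarrow> x t > 0"
begin

lemma weighted_pos: "t \<ge> p \<Longrightarrow> weighted p t > 0"
  by (simp add: weighted_def weight_pos x_pos)

lemma decay_bounds:
  assumes "p + \<tau> \<le> t" "p + 2 \<le> t"
  shows "weight p t * (b t * x (t - \<tau>)) \<le> decay p t"
    and "weight p t * (c t * x (of_int \<lfloor>t - 1\<rfloor>)) \<le> decay p t"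
    and "0 \<le> decay p t"
proof -
  have "0 \<le> t" using assms T0_le_p T0_pos \<tau>_pos by simp
  \<comment> \<open>Both delayed arguments stay where \<open>x\<close> is positive; the floor
    exceeds \<open>t - 2\<close>, whence the 2 in the assumption.\<close>
  have "p \<le> of_int \<lfloor>t - 1\<rfloor>" "p \<le> t - \<tau>"
    using assms by linarith+
  then have "0 \<le> b t * x (t - \<tau>)" "0 \<le> c t * x (of_int \<lfloor>t - 1\<rfloor>)"
    using b_nonneg c_nonneg x_pos \<open>0 \<le> t\<close> by (simp_all add: less_imp_le)
  then show "weight p t * (b t * x (t - \<tau>)) \<le> decay p t"
    and "weight p t * (c t * x (of_int \<lfloor>t - 1\<rfloor>)) \<le> decay p t"
    and "0 \<le> decay p t"
    using weight_pos[of p t] by (simp_all add: decay_def)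
qed

lemma weighted_antimono:
  assumes "p + \<tau> + 2 \<le> u" "u \<le> v"
  shows "weighted p v \<le> weighted p u"
proof -
  \<comment> \<open>The comparison with \<open>K = 0\<close> and \<open>g = 0\<close> expresses that
    \<open>decay p\<close> is nonnegative.\<close>
  have "weighted p v \<le> weighted p u - 0 * integral {u..v} (\<lambda>_. 0)"
  proof (rule weighted_le)
    fix s assume "u \<le> s"
    then show "0 * 0 \<le> decay p s" using decay_bounds(3)[of s] assms \<tau>_pos by simp
  qed (use T0_le_p \<tau>_pos assms in auto)
  then show ?thesis by simp
qed

text \<open>Since \<open>l \<le> \<tau>\<close>, the point \<open>s - \<tau>\<close> never passes
  \<open>t - l\<close>, so the delayed value of \<open>weighted p\<close> is at least its value at
  the left endpoint. The threshold has \<open>3 * \<tau>\<close> because \<open>s - \<tau>\<close>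
  can be as small as \<open>t - 2 * \<tau>\<close> and must be at least
  \<open>p + \<tau> + 2\<close>.\<close>

lemma delay_integral_le_1:
  assumes l: "0 \<le> l" "l \<le> \<tau>" and t: "p + 3 * \<tau> + 2 \<le> t"
  shows "integral {t - l..t} (\<lambda>s. impulse_prod T \<beta> (s - \<tau>) s * b s * exp (integral {s - \<tau>..s} a)) \<le> 1"
proof (rule integral_le_1[OF T0_le_p])
  fix s assume s: "t - l \<le> s" "s < t"
  have "weighted p (t - l) \<le> weighted p (s - \<tau>)"
    using s l t by (intro weighted_antimono) auto
  moreover have "0 \<le> b s * weight (s - \<tau>) s"
    using b_nonneg[of s] weight_pos[of "s - \<tau>" s] s t l T0_pos T0_le_p \<tau>_pos by simp
  ultimately have "weighted p (t - l) * (b s * weight (s - \<tau>) s)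
      \<le> weighted p (s - \<tau>) * (b s * weight (s - \<tau>) s)"
    by (rule mult_right_mono)
  also have "\<dots> = weight p s * (b s * x (s - \<tau>))"
    using weighted_eq[of p "s - \<tau>" s] s t l T0_pos T0_le_p \<tau>_pos by (simp add: mult_ac)
  also have "\<dots> \<le> decay p s"
    by (rule decay_bounds) (use s l t \<tau>_pos in auto)
  finally show "weighted p (t - l)
      * (impulse_prod T \<beta> (s - \<tau>) s * b s * exp (integral {s - \<tau>..s} a)) \<le> decay p s"
    by (simp add: weight_def mult_ac)
qed (use l t \<tau>_pos in \<open>auto intro!: weighted_pos\<close>)

text \<open>Since \<open>l \<le> 1\<close>, the half-open range of \<open>s\<close> lies in one unit
  interval starting at \<open>n\<close>, where the delayed argument is constantly
  \<open>n - 1\<close>. That point is left of the range, so monotonicity of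
  \<open>weighted p\<close> applies.\<close>

lemma floor_integral_le_1:
  assumes l: "0 \<le> l" "l \<le> 1" and n: "p + \<tau> + 3 \<le> real n"
  shows "integral {real n + 1 - l..real n + 1}
    (\<lambda>s. impulse_prod T \<beta> (real n - 1) s * c s * exp (integral {real n - 1..s} a)) \<le> 1"
proof (rule integral_le_1[OF T0_le_p])
  fix s assume s: "real n + 1 - l \<le> s" "s < real n + 1"
  have floor: "of_int \<lfloor>s - 1\<rfloor> = real n - 1"
  proof -
    have "\<lfloor>s - 1\<rfloor> = int n - 1"
      using s l by (intro floor_unique) auto
    then show ?thesis by simp
  qed
  have "weighted p (real n + 1 - l) \<le> weighted p (real n - 1)"
    using s l n by (intro weighted_antimono) auto
  moreover have "0 \<le> c s * weight (real n - 1) s"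
    using c_nonneg[of s] weight_pos[of "real n - 1" s] s l by simp
  ultimately have "weighted p (real n + 1 - l) * (c s * weight (real n - 1) s)
      \<le> weighted p (real n - 1) * (c s * weight (real n - 1) s)"
    by (rule mult_right_mono)
  also have "\<dots> = weight p s * (c s * x (real n - 1))"
    using weighted_eq[of p "real n - 1" s] s n l T0_pos T0_le_p \<tau>_pos by (simp add: mult_ac)
  also have "\<dots> \<le> decay p s"
    unfolding floor[symmetric]
    by (rule decay_bounds) (use s l n \<tau>_pos in auto)
  finally show "weighted p (real n + 1 - l)
      * (impulse_prod T \<beta> (real n - 1) s * c s * exp (integral {real n - 1..s} a)) \<le> decay p s"
    by (simp add: weight_def mult_ac)
qed (use l n \<tau>_pos in \<open>auto intro!: weighted_pos\<close>)

end

section \<open>From bounded integrals to oscillation\<close>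

text \<open>An eventually positive solution would make both integrals at most 1 from some point on,
  hence also both upper limits.\<close>

lemma not_eventually_pos:
  assumes l: "0 \<le> l" "l \<le> \<tau>" "l \<le> 1"
    and lim: "Limsup at_top (\<lambda>t::real. ereal (integral {t - l..t}
            (\<lambda>s. impulse_prod T \<beta> (s - \<tau>) s * b s * exp (integral {s - \<tau>..s} a)))) > 1
       \<or> limsup (\<lambda>n::nat. ereal (integral {real n + 1 - l..real n + 1}
            (\<lambda>s. impulse_prod T \<beta> (real n - 1) s * c s * exp (integral {real n - 1..s} a)))) > 1"
  shows "\<not> (\<forall>\<^sub>F t in at_top. x t > 0)"
proof
  assume "\<forall>\<^sub>F t in at_top. x t > 0"
  then obtain N where N: "\<And>t. t \<ge> N \<Longrightarrow> x t > 0"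
    by (auto simp: eventually_at_top_linorder)
  define p where "p = max N (T 0)"
  have p: "T 0 \<le> p" "\<And>t. t \<ge> p \<Longrightarrow> x t > 0"
    using N by (auto simp: p_def)
  have "\<forall>\<^sub>F t in at_top. ereal (integral {t - l..t}
      (\<lambda>s. impulse_prod T \<beta> (s - \<tau>) s * b s * exp (integral {s - \<tau>..s} a))) \<le> 1"
    using eventually_ge_at_top[of "p + 3 * \<tau> + 2"]
    by eventually_elim (use delay_integral_le_1[OF p l(1,2)] in simp)
  note delay = Limsup_bounded[OF this]
  have "\<forall>\<^sub>F n in sequentially. p + \<tau> + 3 \<le> real n"
    using filterlim_real_sequentially by (auto simp: filterlim_at_top)
  then have "\<forall>\<^sub>F n in sequentially. ereal (integral {real n + 1 - l..real n + 1}
      (\<lambda>s. impulse_prod T \<beta> (real n - 1) s * c s * exp (integral {real n - 1..s} a))) \<le> 1"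
    by eventually_elim (use floor_integral_le_1[OF p l(1,3)] in simp)
  note floor = Limsup_bounded[OF this]
  show False
    using lim leD[OF delay] leD[OF floor] by blast
qed

end

text \<open>Right continuity turns the jump condition into the left limit
  \<open>(1 - \<beta> i) * x (T i)\<close>; beyond \<open>T 0\<close> the filters within half-lines
  are the full filter at \<open>t\<close>.\<close>

lemma impulsive_equation_if_solution:
  assumes "impulsive_solution \<tau> a b c T \<beta> x" "impulses T \<beta>"
    and "T 0 > 0" "\<tau> > 0" "continuous_on {0..} a" "\<forall>t\<ge>0. b t \<ge> 0" "\<forall>t\<ge>0. c t \<ge> 0"
  shows "impulsive_equation T \<beta> \<tau> a b c x"
proof -
  note sol = assms(1)[unfolded impulsive_solution_def]
  interpret impulses T \<beta> by (rule assms(2))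
  show ?thesis
  proof unfold_locales
    fix i :: nat assume i: "i \<ge> 1"
    show right: "(x \<longlongrightarrow> x (T i)) (at_right (T i))"
      using sol i by (simp add: continuous_within)
    obtain L where L: "(x \<longlongrightarrow> L) (at_left (T i))"
      using sol i by blast
    have "x (T i) - L = \<beta> i * x (T i)"
      using sol i right L unfolding jump_def
      by (metis tendsto_Lim trivial_limit_at_left_real trivial_limit_at_right_real)
    then have "L = (1 - \<beta> i) * x (T i)" by (simp add: algebra_simps)
    with L show "(x \<longlongrightarrow> (1 - \<beta> i) * x (T i)) (at_left (T i))" by simp
  next
    fix t assume t: "t > T 0" "t \<notin> impulse_times T"
    have "continuous (at t within {-\<tau>..}) x"
      using sol t assms(3,4) by simp
    moreover have "at t within {-\<tau>..} = at t"
      using t assms(3,4) by (intro at_within_interior) simp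
    ultimately show "isCont x t" by simp
    assume "t \<notin> \<int>"
    then obtain D where "(x has_real_derivative D) (at t within {T 0..})"
      and D: "D + a t * x t + b t * x (t - \<tau>) + c t * x (of_int \<lfloor>t - 1\<rfloor>) = 0"
      using sol t by (meson less_imp_le)
    moreover have "at t within {T 0..} = at t"
      using t by (intro at_within_interior) simp
    moreover have "D = - (a t * x t + b t * x (t - \<tau>) + c t * x (of_int \<lfloor>t - 1\<rfloor>))"
      using D by linarith
    ultimately show "(x has_real_derivative
        - (a t * x t + b t * x (t - \<tau>) + c t * x (of_int \<lfloor>t - 1\<rfloor>))) (at t)"
      by simp
  qed (use assms in auto)
qed

theorem theorem2:
  fixes \<tau> l :: real and a b c :: "real \<Rightarrow> real" and T \<beta> :: "nat \<Rightarrow> real"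
  assumes "T 0 > 0" and "\<tau> > 0"
    and "continuous_on {0..} a"
    and "continuous_on {0..} b" and "\<forall>t\<ge>0. b t \<ge> 0"
    and "continuous_on {0..} c" and "\<forall>t\<ge>0. c t \<ge> 0"
    and "(\<exists>t\<ge>0. b t \<noteq> 0) \<or> (\<exists>t\<ge>0. c t \<noteq> 0)"
    and "strict_mono T" and "filterlim T at_top sequentially"
    and "\<forall>i\<ge>1. \<beta> i < 1"
    and "l = min \<tau> 1"
    and "Limsup at_top (\<lambda>t::real. ereal (integral {t - l..t}
            (\<lambda>s. impulse_prod T \<beta> (s - \<tau>) s * b s * exp (integral {s - \<tau>..s} a)))) > 1
       \<or> limsup (\<lambda>n::nat. ereal (integral {real n + 1 - l..real n + 1}
            (\<lambda>s. impulse_prod T \<beta> (real n - 1) s * c s * exp (integral {real n - 1..s} a)))) > 1"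
  shows "\<forall>x. impulsive_solution \<tau> a b c T \<beta> x \<longrightarrow> oscillatory x"
proof (intro allI impI)
  fix x assume "impulsive_solution \<tau> a b c T \<beta> x"
  moreover have "impulses T \<beta>"
    using assms(9-11) by unfold_locales auto
  ultimately interpret pos: impulsive_equation T \<beta> \<tau> a b c x
    using assms(1-3,5,7) by (intro impulsive_equation_if_solution)
  interpret neg: impulsive_equation T \<beta> \<tau> a b c "\<lambda>t. - x t"
    by (rule pos.uminus)
  have l: "0 \<le> l" "l \<le> \<tau>" "l \<le> 1" using assms(2,12) by auto
  show "oscillatory x"
    using pos.not_eventually_pos[OF l assms(13)] neg.not_eventually_pos[OF l assms(13)]
    by (simp add: oscillatory_def)
qed

end
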